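(* Let $m\ge 3$ be an integer and let $\mathscr{A}=(A_{n,k})_{n\ge k\ge 0}$ be an infinite lower triangular matrix with $A_{n,k}\ne 0$ for all $n\ge k\ge 0$. Then $\mathscr{A}\in SDR_{m+1}$ if and only if $\mathscr{A}\in SDR_m$.
   Context: All matrices are infinite lower triangular matrices $\mathscr{A}=(A_{n,k})_{n\ge k\ge 0}$ with complex entries; we set $A_{n,k}=0$ whenever $k>n$. For an integer $m\ge 3$, $\mathscr{A}$ is called an SDR-matrix of order $m$ (written $\mathscr{A}\in SDR_m$) if for all integers $n,k\ge 0$, all $2\le p\le m-1$ and all $0\le r\le p-1$, $$\prod_{i=0}^{r}A_{n+i,k+r-i}\prod_{i=0}^{p-r-1}A_{n+p-i,k+r+i+1}=\prod_{i=0}^{r}A_{n+p-i,k+p-r+i}\prod_{i=0}^{p-r-1}A_{n+i,k+p-r-i-1}.$$ *)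

theory Defs
  imports Complex_Main
begin

definition lower_triangular :: "(nat \<Rightarrow> nat \<Rightarrow> complex) \<Rightarrow> bool" where
  "lower_triangular A \<longleftrightarrow> (\<forall>n k. k > n \<longrightarrow> A n k = 0)"

text \<open>
  In the stated ranges of p, r and i no subtraction of natural numbers below truncates.
  The order m is meant to be at least 3.
\<close>

definition SDR :: "nat \<Rightarrow> (nat \<Rightarrow> nat \<Rightarrow> complex) set" where
  "SDR m = {A. lower_triangular A \<and>
     (\<forall>n k. \<forall>p\<in>{2..m-1}. \<forall>r\<in>{0..p-1}.
        (\<Prod>i=0..r. A (n + i) (k + r - i)) * (\<Prod>i=0..p-r-1. A (n + p - i) (k + r + i + 1))
      = (\<Prod>i=0..r. A (n + p - i) (k + p - r + i)) * (\<Prod>i=0..p-r-1. A (n + i) (k + p - r - i - 1)))}"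

end

theory Submission
  imports Defs
begin

text \<open>
  The condition for \<open>p = 2\<close> says that the ratios \<open>g n k = A n k / A (n + 1) (k + 1)\<close> have vanishing
  \<open>2 \<times> 2\<close> minors on the triangle, so \<open>g n k = u n * v k\<close>. Telescoping along the diagonals gives
  \<open>A n k = c (n - k) * a n * b k\<close>. The factor \<open>c\<close> is invariant under diagonal shifts, and both
  sides of every SDR identity contain each of \<open>a n, \<dots>, a (n + p)\<close> and \<open>b k, \<dots>, b (k + p)\<close>
  exactly once, so the identities hold for all \<open>p\<close>. When a factor leaves the triangle, both sides
  vanish.
\<close>

text \<open>The product over the antidiagonal of the square block of side \<open>r + 1\<close> with
  upper left corner \<open>(n, k)\<close>. Indexing by that corner turns a diagonal shift into
  adding one number to both arguments.\<close>

definition antidiagonal_prod :: "(nat \<Rightarrow> nat \<Rightarrow> complex) \<Rightarrow> nat \<Rightarrow> nat \<Rightarrow> nat \<Rightarrow> complex" where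
  "antidiagonal_prod A n k r = (\<Prod>i=0..r. A (n + i) (k + r - i))"

lemma antidiagonal_prod_rev:
  "antidiagonal_prod A n k r = (\<Prod>i=0..r. A (n + r - i) (k + i))"
  unfolding antidiagonal_prod_def
  by (rule prod.reindex_bij_witness[of _ "\<lambda>i. r - i" "\<lambda>i. r - i"]) auto

text \<open>Geometric form of the condition: the diagonal of a block of side \<open>p + 1\<close> is
  cut into blocks of sides \<open>r + 1\<close> and \<open>p - r\<close>, in either order.\<close>

lemma mem_SDR_iff:
  "A \<in> SDR m \<longleftrightarrow> lower_triangular A \<and>
     (\<forall>n k. \<forall>p\<in>{2..m-1}. \<forall>r\<le>p-1.
        antidiagonal_prod A n k r * antidiagonal_prod A (n + r + 1) (k + r + 1) (p - r - 1)
      = antidiagonal_prod A n k (p - r - 1) * antidiagonal_prod A (n + p - r) (k + p - r) r)"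
proof -
  have left: "(\<Prod>i=0..p-r-1. A (n + p - i) (k + r + i + 1))
      = antidiagonal_prod A (n + r + 1) (k + r + 1) (p - r - 1)"
    if "p \<ge> 2" "r \<le> p - 1" for n k p r
    unfolding antidiagonal_prod_rev by (rule prod.cong) (use that in \<open>auto simp: algebra_simps\<close>)
  have right: "(\<Prod>i=0..r. A (n + p - i) (k + p - r + i))
      = antidiagonal_prod A (n + p - r) (k + p - r) r"
    if "p \<ge> 2" "r \<le> p - 1" for n k p r
    unfolding antidiagonal_prod_rev by (rule prod.cong) (use that in auto)
  have low: "(\<Prod>i=0..p-r-1. A (n + i) (k + p - r - i - 1)) = antidiagonal_prod A n k (p - r - 1)"
    if "p \<ge> 2" "r \<le> p - 1" for n k p r
    unfolding antidiagonal_prod_def by (rule prod.cong) (use that in auto)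
  have "((\<Prod>i=0..r. A (n + i) (k + r - i)) * (\<Prod>i=0..p-r-1. A (n + p - i) (k + r + i + 1))
      = (\<Prod>i=0..r. A (n + p - i) (k + p - r + i)) * (\<Prod>i=0..p-r-1. A (n + i) (k + p - r - i - 1)))
    \<longleftrightarrow> antidiagonal_prod A n k r * antidiagonal_prod A (n + r + 1) (k + r + 1) (p - r - 1)
      = antidiagonal_prod A n k (p - r - 1) * antidiagonal_prod A (n + p - r) (k + p - r) r"
    if "p \<ge> 2" "r \<le> p - 1" for n k p r
    unfolding left[OF that] right[OF that] low[OF that] antidiagonal_prod_def[of A n k r, symmetric]
    \<comment> \<open>On its right-hand side the definition of \<open>SDR\<close> lists the lower
      block first.\<close>
    by (subst (3) mult.commute) (rule refl)
  then show ?thesis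
    unfolding SDR_def mem_Collect_eq Ball_def atLeastAtMost_iff
    by (intro conj_cong refl all_cong1 imp_cong) auto
qed

text \<open>The case \<open>p = 2\<close>, \<open>r = 0\<close>: the six neighbours of position
  \<open>(n+1, k+1)\<close> split into two triples with equal products.\<close>

lemma star_of_David:
  assumes "A \<in> SDR m" "m \<ge> 3"
  shows "A n k * (A (n+2) (k+1) * A (n+1) (k+2)) = A (n+2) (k+2) * (A n (k+1) * A (n+1) k)"
proof -
  have "antidiagonal_prod A n k 0 * antidiagonal_prod A (n + 0 + 1) (k + 0 + 1) (2 - 0 - 1)
      = antidiagonal_prod A n k (2 - 0 - 1) * antidiagonal_prod A (n + 2 - 0) (k + 2 - 0) 0"
    using assms unfolding mem_SDR_iff by force
  then show ?thesis
    by (simp add: antidiagonal_prod_def numeral_2_eq_2 algebra_simps)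
qed

lemma SDR_factorization:
  assumes "A \<in> SDR m" "m \<ge> 3" and nz: "\<And>n k. k \<le> n \<Longrightarrow> A n k \<noteq> 0"
  shows "\<exists>a b c. \<forall>n k. k \<le> n \<longrightarrow> A n k = c (n - k) * a n * b k"
proof -
  define g where "g n k = A n k / A (n+1) (k+1)" for n k
  have gnz: "g n k \<noteq> 0" if "k \<le> n" for n k
    using that nz by (simp add: g_def)
  \<comment> \<open>The left side telescopes to \<open>A n k / A (n+2) (k+2)\<close>. The bound
    keeps all six entries inside the triangle, hence nonzero.\<close>
  have minor: "g n k * g (n+1) (k+1) = g n (k+1) * g (n+1) k" if "k + 1 \<le> n" for n k
    using star_of_David[OF assms(1,2), of n k] that nz
    by (simp add: g_def divide_simps) (simp add: algebra_simps)
  have row: "g (n+1) k * g n 0 = g n k * g (n+1) 0" if "k \<le> n" for n k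
    using that
  proof (induction k)
    case (Suc k)
    have IH: "g (n+1) k * g n 0 = g n k * g (n+1) 0" using Suc by simp
    \<comment> \<open>The minor moves the row shift from column \<open>k+1\<close> to column
      \<open>k\<close>, where the induction hypothesis applies; the nonzero factor
      \<open>g n k\<close> cancels at the end.\<close>
    have "g n k * (g (n+1) (k+1) * g n 0) = g n (k+1) * (g (n+1) k * g n 0)"
      using minor[of k n] Suc.prems by (simp add: algebra_simps)
    also have "\<dots> = g n k * (g n (k+1) * g (n+1) 0)"
      unfolding IH by (simp add: algebra_simps)
    finally show ?case using gnz[of k n] Suc.prems by simp
  qed simp
  define u where "u n = g n 0" for n
  \<comment> \<open>By \<open>row\<close>, \<open>g n k / g n 0\<close> does not depend on
    \<open>n \<ge> k\<close>; it is read off at \<open>n = k\<close>, where column \<open>k\<close>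
    enters the triangle.\<close>
  define v where "v k = g k k / g k 0" for k
  have uv: "g n k = u n * v k" if "k \<le> n" for n k
    using that
  proof (induction n rule: dec_induct)
    case base
    then show ?case using gnz[of 0 k] by (simp add: u_def v_def)
  next
    case (step n)
    have "g (Suc n) k * g n 0 = g n 0 * (u (Suc n) * v k)"
      using row[OF step.hyps(1)] step.IH by (simp add: u_def ac_simps)
    then show ?case using gnz[of 0 n] by simp
  qed
  have unz: "u n \<noteq> 0" and vnz: "v n \<noteq> 0" for n
    using uv[of n n] gnz[of n n] by auto
  define a where "a n = (\<Prod>j<n. inverse (u j))" for n
  define b where "b k = (\<Prod>j<k. inverse (v j))" for k
  \<comment> \<open>Column 0 determines \<open>c\<close>, since \<open>b 0\<close> is an empty
    product; each diagonal is then followed down from there.\<close>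
  define c where "c d = A d 0 / a d" for d
  have anz: "a n \<noteq> 0" for n using unz by (simp add: a_def)
  have "A (k + d) k = c d * a (k + d) * b k" for k d
  proof (induction k)
    case 0
    then show ?case using anz by (simp add: c_def b_def)
  next
    case (Suc k)
    have "A (k + d) k = u (k + d) * v k * A (Suc k + d) (Suc k)"
      using uv[of k "k + d"] nz[of "Suc k" "Suc k + d"] by (simp add: g_def field_simps)
    then have "A (Suc k + d) (Suc k) = inverse (u (k + d)) * inverse (v k) * A (k + d) k"
      using unz vnz by (simp add: field_simps)
    also have "\<dots> = c d * a (Suc k + d) * b (Suc k)"
      unfolding Suc.IH by (simp add: a_def b_def algebra_simps)
    finally show ?case .
  qed
  then have "\<forall>n k. k \<le> n \<longrightarrow> A n k = c (n - k) * a n * b k"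
    by (metis le_add_diff_inverse)
  then show ?thesis by (intro exI)
qed

text \<open>The index of \<open>c\<close> is row minus column, \<open>(n + i) - (k + r - i)\<close>;
  the bound \<open>k + r \<le> n\<close> prevents truncation.\<close>

lemma antidiagonal_prod_factorized:
  assumes "\<And>n k. k \<le> n \<Longrightarrow> A n k = c (n - k) * a n * b k" "k + r \<le> n"
  shows "antidiagonal_prod A n k r
    = (\<Prod>i\<le>r. c (n - k + 2 * i - r)) * prod a {n..<n+r+1} * prod b {k..<k+r+1}"
proof -
  have "antidiagonal_prod A n k r = (\<Prod>i\<le>r. c (n - k + 2 * i - r) * a (n + i) * b (k + (r - i)))"
    unfolding antidiagonal_prod_def atLeast0AtMost
    by (rule prod.cong) (use assms(2) in \<open>auto simp: assms(1) intro!: arg_cong[of _ _ c]\<close>)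
  moreover have "(\<Prod>i\<le>r. a (n + i)) = prod a {n..<n+r+1}"
    by (rule prod.reindex_bij_witness[of _ "\<lambda>i. i - n" "\<lambda>i. n + i"]) auto
  moreover have "(\<Prod>i\<le>r. b (k + (r - i))) = prod b {k..<k+r+1}"
    by (rule prod.reindex_bij_witness[of _ "\<lambda>i. k + r - i" "\<lambda>i. k + (r - i)"]) auto
  ultimately show ?thesis by (simp add: prod.distrib)
qed

lemma antidiagonal_prod_eq_0:
  assumes "lower_triangular A" "n < k + r"
  shows "antidiagonal_prod A n k r = 0"
  unfolding antidiagonal_prod_def
  by (rule prod_zero) (use assms in \<open>auto simp: lower_triangular_def intro!: bexI[of _ 0]\<close>)

lemma factorized_mem_SDR:
  assumes lt: "lower_triangular A" and fac: "\<And>n k. k \<le> n \<Longrightarrow> A n k = c (n - k) * a n * b k"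
  shows "A \<in> SDR m"
proof -
  \<comment> \<open>Writing \<open>s\<close> for \<open>p - r - 1\<close> makes the identity an
    exchange of \<open>r\<close> and \<open>s\<close>.\<close>
  have "antidiagonal_prod A n k r * antidiagonal_prod A (n + r + 1) (k + r + 1) s
      = antidiagonal_prod A n k s * antidiagonal_prod A (n + s + 1) (k + s + 1) r" for n k r s
  proof (cases "k + r \<le> n \<and> k + s \<le> n")
    case True
    have split: "prod f {x..<x+r+1} * prod f {x+r+1..<x+r+1+s+1}
        = prod f {x..<x+s+1} * prod f {x+s+1..<x+s+1+r+1}" for f :: "nat \<Rightarrow> complex" and x
      by (simp add: prod.atLeastLessThan_concat ac_simps del: prod.op_ivl_Suc)
    define C where "C t = (\<Prod>i\<le>t. c (n - k + 2 * i - t))" for t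
    \<comment> \<open>\<open>C t\<close> is free of \<open>j\<close> because the shift preserves
      \<open>n - k\<close>.\<close>
    have low: "antidiagonal_prod A (n + j) (k + j) t
        = C t * prod a {n+j..<n+j+t+1} * prod b {k+j..<k+j+t+1}" if "k + t \<le> n" for j t
      using antidiagonal_prod_factorized[where A = A and a = a and b = b and c = c, OF fac,
          of "k + j" t "n + j"] that
      by (simp add: C_def)
    have "antidiagonal_prod A n k r * antidiagonal_prod A (n + (r + 1)) (k + (r + 1)) s
      = C r * C s * (prod a {n..<n+r+1} * prod a {n+r+1..<n+r+1+s+1})
        * (prod b {k..<k+r+1} * prod b {k+r+1..<k+r+1+s+1})"
      using low[of r 0] low[of s "r + 1"] True by (simp add: ac_simps del: prod.op_ivl_Suc)
    also have "\<dots> = antidiagonal_prod A n k s * antidiagonal_prod A (n + (s + 1)) (k + (s + 1)) r"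
      unfolding split
      using low[of s 0] low[of r "s + 1"] True by (simp add: ac_simps del: prod.op_ivl_Suc)
    finally show ?thesis by simp
  next
    case False
    \<comment> \<open>If \<open>n < k + r\<close>, both products of parameter \<open>r\<close>
      vanish, one on each side; likewise for \<open>s\<close>.\<close>
    then show ?thesis by (auto simp: antidiagonal_prod_eq_0[OF lt])
  qed
  note sym = this
  have "antidiagonal_prod A n k r * antidiagonal_prod A (n + r + 1) (k + r + 1) (p - r - 1)
      = antidiagonal_prod A n k (p - r - 1) * antidiagonal_prod A (n + p - r) (k + p - r) r"
    if "p \<in> {2..m-1}" "r \<le> p - 1" for n k p r
  proof -
    have "n + (p - r - 1) + 1 = n + p - r" "k + (p - r - 1) + 1 = k + p - r"
      using that by auto
    then show ?thesis using sym[of n k r "p - r - 1"] by (simp only:)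
  qed
  then show ?thesis using lt unfolding mem_SDR_iff by blast
qed

theorem theorem2p3:
  fixes m :: nat and A :: "nat \<Rightarrow> nat \<Rightarrow> complex"
  assumes "m \<ge> 3"
    and "lower_triangular A"
    and "\<And>n k. k \<le> n \<Longrightarrow> A n k \<noteq> 0"
  shows "A \<in> SDR (m + 1) \<longleftrightarrow> A \<in> SDR m"
proof -
  \<comment> \<open>Membership for one order at least 3 gives the factorization, hence membership
    for every order; both directions follow.\<close>
  have "A \<in> SDR l'" if l: "A \<in> SDR l" "l \<ge> 3" for l l'
  proof -
    obtain a b c where fac: "\<forall>n k. k \<le> n \<longrightarrow> A n k = c (n - k) * a n * b k"
      using SDR_factorization[OF l] assms(3) by blast
    show ?thesis
      by (rule factorized_mem_SDR[where a = a and b = b and c = c]) (use assms(2) fac in simp_all)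
  qed
  then show ?thesis using assms(1) trans_le_add1 by blast
qed

end
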